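(* Let $T\in\Delta$ be a labelled ideal tetrahedron and let $\alpha,\beta\in\mathbb R$ be respectively the determinant and the permanent of the doubly stochastic Gram matrix $G_T$ of $T$. Then the only tetrahedra $T'\in\Delta$ whose doubly stochastic Gram matrices satisfy $\det G_{T'}=\alpha$ and $\operatorname{per}G_{T'}=\beta$ are those that differ from $T$ by the action of the symmetric group $S_3$ on $\Delta$ (by permutations of coordinates). In other words, the pair $(\alpha,\beta)$ determines a unique (non-labelled) ideal tetrahedron modulo isometries.
   Context: Let $V$ be a $4$-dimensional real vector space with a symmetric bilinear form $\langle-,-\rangle$ of signature $---+$. Hyperbolic $3$-space is $\{\boldsymbol p\in\mathbb PV\mid\langle p,p\rangle>0\}$, and the points $\boldsymbol p\in\mathbb PV$ with $\langle p,p\rangle=0$ are the ideal points ($p\in V$ denotes a representative of $\boldsymbol p$). A labelled ideal tetrahedron is a $4$-tuple $(\boldsymbol v_1,\boldsymbol v_2,\boldsymbol v_3,\boldsymbol v_4)$ of ideal points (its vertices); an ideal tetrahedron is a labelled ideal tetrahedron modulo permutations of the vertices. A Gram matrix of it is $[\langle v_i,v_j\rangle]$ for some choice of representatives $v_i\in V$. A square matrix is doubly stochastic if its entries are non-negative and each row and each column sums to $1$. Only (labelled) ideal tetrahedra admitting a doubly stochastic Gram matrix are considered; such a Gram matrix is then unique. Let $\Delta:=\{(x,y,z)\in\mathbb R^3\mid x+y+z=1,\ x\le y+z,\ y\le z+x,\ z\le x+y\}$. The set of labelled ideal tetrahedra admitting a doubly stochastic Gram matrix, modulo isometries preserving the order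 of the vertices, is identified with $\Delta$: the point $T=(r,s,t)\in\Delta$ corresponds to the class of labelled ideal tetrahedra whose doubly stochastic Gram matrix is $$G_T=\begin{pmatrix}0&r&s&t\\ r&0&t&s\\ s&t&0&r\\ t&s&r&0\end{pmatrix}.$$ The action of the symmetric group $S_4$ on labelled ideal tetrahedra by permutations of vertices induces on $\Delta$ the action of $S_3$ by permutations of the coordinates $(r,s,t)$. The permanent of an $m\times m$ matrix $A=[a_{ij}]$ is $\operatorname{per}A:=\sum_{\sigma\in S_m}a_{1\sigma(1)}\cdots a_{m\sigma(m)}$. *)

theory Defs
  imports "HOL-Analysis.Analysis"
begin

(* The index type 4 is Z/4, so its element 4 is 0; the numerals 1, 2, 3, 4 are its four
   distinct elements. *)

definition lorentzian :: "('v::real_vector \<Rightarrow> 'v \<Rightarrow> real) \<Rightarrow> bool" where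
  "lorentzian B \<longleftrightarrow> bilinear B \<and> (\<forall>x y. B x y = B y x) \<and>
     (\<exists>e :: 4 \<Rightarrow> 'v. inj e \<and> independent (range e) \<and> span (range e) = UNIV \<and>
        (\<forall>i j. B (e i) (e j) = (if i = j then (if i = 4 then 1 else -1) else 0)))"

(* A point of the projective space PV is the line span {p} through a nonzero p. *)
definition ideal_points :: "('v::real_vector \<Rightarrow> 'v \<Rightarrow> real) \<Rightarrow> 'v set set" where
  "ideal_points B = {span {p} | p. p \<noteq> 0 \<and> B p p = 0}"

definition is_gram_matrix ::
  "('v::real_vector \<Rightarrow> 'v \<Rightarrow> real) \<Rightarrow> ('n \<Rightarrow> 'v set) \<Rightarrow> real^'n^'n::finite \<Rightarrow> bool" where
  "is_gram_matrix B P G \<longleftrightarrow>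
     (\<exists>v. (\<forall>i. v i \<noteq> 0 \<and> P i = span {v i}) \<and> G = (\<chi> i j. B (v i) (v j)))"

definition doubly_stochastic :: "real^'n^'n::finite \<Rightarrow> bool" where
  "doubly_stochastic A \<longleftrightarrow> (\<forall>i j. 0 \<le> A $ i $ j) \<and>
     (\<forall>i. (\<Sum>j\<in>UNIV. A $ i $ j) = 1) \<and> (\<forall>j. (\<Sum>i\<in>UNIV. A $ i $ j) = 1)"

definition ds_gram_matrix ::
  "('v::real_vector \<Rightarrow> 'v \<Rightarrow> real) \<Rightarrow> (4 \<Rightarrow> 'v set) \<Rightarrow> real^4^4 \<Rightarrow> bool" where
  "ds_gram_matrix B P G \<longleftrightarrow> is_gram_matrix B P G \<and> doubly_stochastic G"

(* The vertices are not required to be distinct: the corners of Delta, such as (0, 1/2, 1/2),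
   are classes of tetrahedra with coinciding vertices. *)
definition labelled_ideal_tetrahedra ::
  "('v::real_vector \<Rightarrow> 'v \<Rightarrow> real) \<Rightarrow> (4 \<Rightarrow> 'v set) set" where
  "labelled_ideal_tetrahedra B =
     {P. (\<forall>i. P i \<in> ideal_points B) \<and> (\<exists>G. ds_gram_matrix B P G)}"

(* An isometry of hyperbolic space is the projectivization of such an f; it sends the line l
   to f ` l. *)
definition form_isometry ::
  "('v::real_vector \<Rightarrow> 'v \<Rightarrow> real) \<Rightarrow> ('v \<Rightarrow> 'v) \<Rightarrow> bool" where
  "form_isometry B f \<longleftrightarrow> linear f \<and> bij f \<and> (\<forall>x y. B (f x) (f y) = B x y)"

(* The equivalence classes are the non-labelled ideal tetrahedra modulo isometries. *)
definition tetrahedron_congruence ::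
  "('v::real_vector \<Rightarrow> 'v \<Rightarrow> real) \<Rightarrow> ((4 \<Rightarrow> 'v set) \<times> (4 \<Rightarrow> 'v set)) set" where
  "tetrahedron_congruence B =
     {(P, Q). P \<in> labelled_ideal_tetrahedra B \<and> Q \<in> labelled_ideal_tetrahedra B \<and>
        (\<exists>f \<sigma>. form_isometry B f \<and> \<sigma> permutes UNIV \<and> (\<forall>i. f ` P i = Q (\<sigma> i)))}"

definition Delta :: "(real^3) set" where
  "Delta = {T. T $ 1 + T $ 2 + T $ 3 = 1 \<and>
     T $ 1 \<le> T $ 2 + T $ 3 \<and> T $ 2 \<le> T $ 3 + T $ 1 \<and> T $ 3 \<le> T $ 1 + T $ 2}"

definition gram_of :: "real^3 \<Rightarrow> real^4^4" where
  "gram_of T = (let r = T $ 1; s = T $ 2; t = T $ 3 in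
     vector [vector [0, r, s, t],
             vector [r, 0, t, s],
             vector [s, t, 0, r],
             vector [t, s, r, 0]])"

definition permanent :: "'a::comm_ring_1^'n^'n::finite \<Rightarrow> 'a" where
  "permanent A = (\<Sum>\<sigma> | \<sigma> permutes UNIV. \<Prod>i\<in>UNIV. A $ i $ \<sigma> i)"

end

(* For T = (r, s, t) in Delta the eigenvalues of the Gram matrix are 1, 2r - 1, 2s - 1, 2t - 1,
   and its permanent is (r^2 + s^2 + t^2)^2. Since r + s + t = 1, the permanent determines
   r^2 + s^2 + t^2, hence the second elementary symmetric function of r, s, t, and the determinant
   then determines rst, hence {r, s, t}. Every permutation of the coordinates comes from a
   permutation of the vertices, and two tetrahedra with the same doubly stochastic Gram matrix are
   isometric by Witt's extension theorem, because the sum of the vertices has positive square. *)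

theory Submission
  imports Defs
begin

section \<open>Determinant and permanent of \<open>gram_of T\<close> as symmetric functions\<close>

lemma vector_4 [simp]:
  "(vector [x, y, z, w] :: ('a::zero)^4) $ 1 = x"
  "(vector [x, y, z, w] :: ('a::zero)^4) $ 2 = y"
  "(vector [x, y, z, w] :: ('a::zero)^4) $ 3 = z"
  "(vector [x, y, z, w] :: ('a::zero)^4) $ 4 = w"
  unfolding vector_def by simp_all

lemma prod_UNIV_3: "prod f (UNIV :: 3 set) = f 1 * f 2 * f 3"
  unfolding UNIV_3 by (simp add: ac_simps)

lemma prod_UNIV_4: "prod f (UNIV :: 4 set) = f 1 * f 2 * f 3 * f 4"
  unfolding UNIV_4 by (simp add: ac_simps)

lemma gram_of_nth:
  "gram_of T = vector [vector [0, T $ 1, T $ 2, T $ 3], vector [T $ 1, 0, T $ 3, T $ 2],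
     vector [T $ 2, T $ 3, 0, T $ 1], vector [T $ 3, T $ 2, T $ 1, 0]]"
  by (simp add: gram_of_def Let_def)

text \<open>Every permutation of the four indices factors uniquely into such transpositions, so
  determinant and permanent become explicit sums of 24 terms.\<close>

lemma sum_permutations_4:
  "(\<Sum>p | p permutes (UNIV :: 4 set). f p) =
     (\<Sum>a\<in>{1, 2, 3, 4}. \<Sum>b\<in>{2, 3, 4}. \<Sum>c\<in>{3, 4}.
        f (Transposition.transpose 1 a \<circ> (Transposition.transpose 2 b \<circ> Transposition.transpose 3 c)))"
proof -
  have 1: "finite {2, 3, 4 :: 4}" "1 \<notin> {2, 3, 4 :: 4}"
    and 2: "finite {3, 4 :: 4}" "2 \<notin> {3, 4 :: 4}"
    and 3: "finite {4 :: 4}" "3 \<notin> {4 :: 4}"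
    by auto
  show ?thesis
    unfolding UNIV_4 sum_over_permutations_insert [OF 1] sum_over_permutations_insert [OF 2]
      sum_over_permutations_insert [OF 3] permutes_sing
    by simp
qed

text \<open>The product of the eigenvalues belonging to the characters of the Klein four-group, with
  three sign changes collected in front. It holds for every \<open>T\<close>, and its symmetry in
  the coordinates is visible.\<close>

lemma det_gram_of:
  "det (gram_of T) = - (\<Sum>i\<in>UNIV. T $ i) * (\<Prod>k\<in>UNIV. (\<Sum>i\<in>UNIV. T $ i) - 2 * T $ k)"
  unfolding det_def sum_permutations_4 prod_UNIV_4
  by (simp add: sign_compose sign_swap_id permutation_swap_id permutation_compose gram_of_nth
      sum_3 prod_UNIV_3)
    (simp add: algebra_simps)

text \<open>Only the nine derangements contribute: the double transpositions give the fourth powers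
  of the coordinates, and the six 4-cycles give each product of two distinct squares twice.\<close>

lemma permanent_gram_of: "permanent (gram_of T) = (\<Sum>i\<in>UNIV. (T $ i)\<^sup>2)\<^sup>2"
  unfolding permanent_def sum_permutations_4 prod_UNIV_4
  by (simp add: gram_of_nth sum_3) (simp add: algebra_simps power2_eq_square)

text \<open>When the coordinates sum to 1, each triangle inequality bounds one coordinate by 1/2;
  this form is visibly symmetric.\<close>

lemma Delta_iff: "T \<in> Delta \<longleftrightarrow> (\<Sum>i\<in>UNIV. T $ i) = 1 \<and> (\<forall>i. T $ i \<le> 1/2)"
  by (auto simp: Delta_def sum_3 forall_3)

section \<open>Recovering numbers from their symmetric functions\<close>

text \<open>Squares are used instead of the product because they survive the removal of a common
  entry from two triples, even when that entry is 0.\<close>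

lemma pair_eq_if_power_sums_eq:
  fixes a b x y :: real
  assumes "x + y = a + b" "x\<^sup>2 + y\<^sup>2 = a\<^sup>2 + b\<^sup>2"
  shows "x = a \<and> y = b \<or> x = b \<and> y = a"
proof -
  have y: "y = a + b - x" using assms(1) by simp
  have "(x - a) * (x - b) = 0"
    using assms(2) unfolding y by (simp add: power2_eq_square algebra_simps)
  then show ?thesis using assms(1) by auto
qed

text \<open>The hypotheses fix all elementary symmetric functions, so \<open>x\<close> is a root of
  the monic cubic with roots \<open>a\<close>, \<open>b\<close>, \<open>c\<close>; the other two
  entries then fall to the pair case.\<close>

lemma triple_eq_if_power_sums_eq:
  fixes a b c x y z :: real
  assumes 1: "x + y + z = a + b + c" and 2: "x\<^sup>2 + y\<^sup>2 + z\<^sup>2 = a\<^sup>2 + b\<^sup>2 + c\<^sup>2"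
    and 3: "x * y * z = a * b * c"
  shows "(x, y, z) \<in> {(a, b, c), (a, c, b), (b, a, c), (b, c, a), (c, a, b), (c, b, a)}"
proof -
  have e2: "x * y + y * z + z * x = a * b + b * c + c * a"
  proof -
    have "(x + y + z)\<^sup>2 = (a + b + c)\<^sup>2" using 1 by simp
    then show ?thesis using 2 by (simp add: power2_eq_square algebra_simps)
  qed
  have "(x - a) * (x - b) * (x - c) =
      x * x * x - (a + b + c) * (x * x) + (a * b + b * c + c * a) * x - a * b * c"
    by (simp add: algebra_simps)
  also have "\<dots> = 0"
    unfolding 1 [symmetric] e2 [symmetric] 3 [symmetric] by (simp add: algebra_simps)
  finally consider "x = a" | "x = b" | "x = c" by auto
  then show ?thesis
  proof cases
    case 1
    then show ?thesis using pair_eq_if_power_sums_eq [of y z b c] assms by auto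
  next
    case 2
    then show ?thesis using pair_eq_if_power_sums_eq [of y z a c] assms by auto
  next
    case 3
    then show ?thesis using pair_eq_if_power_sums_eq [of y z a b] assms by auto
  qed
qed

section \<open>Coordinate permutations from vertex permutations\<close>

text \<open>Coordinate k of \<open>T\<close> is the Gram entry of vertices 1 and k + 1. Hence a
  permutation of the coordinates lifts to the vertex permutation that fixes 1 and acts on 2, 3, 4
  with indices shifted by one.\<close>

lemma gram_of_relabel:
  assumes "(S $ 1, S $ 2, S $ 3) \<in> {(T $ 1, T $ 2, T $ 3), (T $ 1, T $ 3, T $ 2), (T $ 2, T $ 1, T $ 3),
    (T $ 2, T $ 3, T $ 1), (T $ 3, T $ 1, T $ 2), (T $ 3, T $ 2, T $ 1)}"
  shows "\<exists>\<sigma>. \<sigma> permutes UNIV \<and> S = (\<chi> i. T $ \<sigma> i)"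
    and "\<exists>\<pi>. \<pi> permutes UNIV \<and> (\<forall>i j. gram_of S $ i $ j = gram_of T $ \<pi> i $ \<pi> j)"
proof -
  let ?t = "Transposition.transpose :: 3 \<Rightarrow> _" and ?u = "Transposition.transpose :: 4 \<Rightarrow> _"
  have t: "?t i j permutes UNIV" for i j by (rule permutes_swap_id) simp_all
  have u: "?u i j permutes UNIV" for i j by (rule permutes_swap_id) simp_all
  consider "S $ 1 = T $ 1" "S $ 2 = T $ 2" "S $ 3 = T $ 3"
    | "S $ 1 = T $ 1" "S $ 2 = T $ 3" "S $ 3 = T $ 2"
    | "S $ 1 = T $ 2" "S $ 2 = T $ 1" "S $ 3 = T $ 3"
    | "S $ 1 = T $ 2" "S $ 2 = T $ 3" "S $ 3 = T $ 1"
    | "S $ 1 = T $ 3" "S $ 2 = T $ 1" "S $ 3 = T $ 2"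
    | "S $ 1 = T $ 3" "S $ 2 = T $ 2" "S $ 3 = T $ 1"
    using assms by auto
  then have "(\<exists>\<sigma>. \<sigma> permutes UNIV \<and> S = (\<chi> i. T $ \<sigma> i)) \<and>
    (\<exists>\<pi>. \<pi> permutes UNIV \<and> (\<forall>i j. gram_of S $ i $ j = gram_of T $ \<pi> i $ \<pi> j))"
  proof cases
    case 1
    then show ?thesis
      by (intro conjI exI [where x = id])
         (simp_all add: permutes_id vec_eq_iff forall_3 forall_4 gram_of_nth)
  next
    case 2
    then show ?thesis
      by (intro conjI exI [where x = "?t 2 3"] exI [where x = "?u 3 4"])
         (simp_all add: t u vec_eq_iff forall_3 forall_4 gram_of_nth)
  next
    case 3
    then show ?thesis
      by (intro conjI exI [where x = "?t 1 2"] exI [where x = "?u 2 3"])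
         (simp_all add: t u vec_eq_iff forall_3 forall_4 gram_of_nth)
  next
    case 4
    then show ?thesis
      by (intro conjI exI [where x = "?t 1 2 \<circ> ?t 2 3"] exI [where x = "?u 2 3 \<circ> ?u 3 4"])
         (simp_all add: t u permutes_compose vec_eq_iff forall_3 forall_4 gram_of_nth)
  next
    case 5
    then show ?thesis
      by (intro conjI exI [where x = "?t 2 3 \<circ> ?t 1 2"] exI [where x = "?u 3 4 \<circ> ?u 2 3"])
         (simp_all add: t u permutes_compose vec_eq_iff forall_3 forall_4 gram_of_nth)
  next
    case 6
    then show ?thesis
      by (intro conjI exI [where x = "?t 1 3"] exI [where x = "?u 2 4"])
         (simp_all add: t u vec_eq_iff forall_3 forall_4 gram_of_nth)
  qed
  then show "\<exists>\<sigma>. \<sigma> permutes UNIV \<and> S = (\<chi> i. T $ \<sigma> i)"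
    and "\<exists>\<pi>. \<pi> permutes UNIV \<and> (\<forall>i j. gram_of S $ i $ j = gram_of T $ \<pi> i $ \<pi> j)"
    by auto
qed

section \<open>Lorentzian forms\<close>

lemma lorentzianD:
  assumes "lorentzian B"
  shows "bilinear B" "B x y = B y x"
  using assms by (auto simp: lorentzian_def)

lemmas bilinear_form_simps =
  bilinear_ladd bilinear_radd bilinear_lmul bilinear_rmul bilinear_lsub bilinear_rsub
  bilinear_lneg bilinear_rneg bilinear_lzero bilinear_rzero

lemma lorentzian_coordinates:
  fixes B :: "'v::real_vector \<Rightarrow> 'v \<Rightarrow> real"
  assumes "lorentzian B"
  obtains e :: "4 \<Rightarrow> 'v"
  where "\<And>x. \<exists>c. x = (\<Sum>i\<in>UNIV. c i *\<^sub>R e i)"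
    and "\<And>c d. B (\<Sum>i\<in>UNIV. c i *\<^sub>R e i) (\<Sum>i\<in>UNIV. d i *\<^sub>R e i) =
           c 4 * d 4 - c 1 * d 1 - c 2 * d 2 - c 3 * d 3"
proof -
  obtain e :: "4 \<Rightarrow> 'v" where e: "inj e" "span (range e) = UNIV"
    "\<And>i j. B (e i) (e j) = (if i = j then (if i = 4 then 1 else -1) else 0)"
    using assms unfolding lorentzian_def by metis
  note bil = lorentzianD(1) [OF assms]
  have "\<exists>c. x = (\<Sum>i\<in>UNIV. c i *\<^sub>R e i)" for x
  proof -
    have "x \<in> span (range e)" using e(2) by simp
    then obtain u where "x = (\<Sum>v\<in>range e. u v *\<^sub>R v)"
      by (auto simp: span_finite)
    then show ?thesis using e(1) by (auto simp: sum.reindex)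
  qed
  moreover have "B (\<Sum>i\<in>UNIV. c i *\<^sub>R e i) (\<Sum>i\<in>UNIV. d i *\<^sub>R e i) =
      c 4 * d 4 - c 1 * d 1 - c 2 * d 2 - c 3 * d 3" for c d
    by (simp add: sum_4 bilinear_form_simps [OF bil] e(3))
  ultimately show ?thesis using that by blast
qed

text \<open>The signature has a single plus sign, so the orthogonal complement of a positive vector
  is negative definite. In coordinates this is Cauchy-Schwarz for the three negative
  directions.\<close>

lemma lorentzian_orthogonal_eq_0:
  fixes B :: "'v::real_vector \<Rightarrow> 'v \<Rightarrow> real"
  assumes L: "lorentzian B" and p: "B p p > 0" and px: "B p x = 0" and x: "B x x \<ge> 0"
  shows "x = 0"
proof -
  obtain e :: "4 \<Rightarrow> 'v" where e: "\<And>x. \<exists>c. x = (\<Sum>i\<in>UNIV. c i *\<^sub>R e i)"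
    "\<And>c d. B (\<Sum>i\<in>UNIV. c i *\<^sub>R e i) (\<Sum>i\<in>UNIV. d i *\<^sub>R e i) =
       c 4 * d 4 - c 1 * d 1 - c 2 * d 2 - c 3 * d 3"
    by (rule lorentzian_coordinates [OF L]) (rule that)
  obtain c d where c: "p = (\<Sum>i\<in>UNIV. c i *\<^sub>R e i)" and d: "x = (\<Sum>i\<in>UNIV. d i *\<^sub>R e i)"
    using e(1) by metis
  let ?cc = "(c 1)\<^sup>2 + (c 2)\<^sup>2 + (c 3)\<^sup>2" and ?dd = "(d 1)\<^sup>2 + (d 2)\<^sup>2 + (d 3)\<^sup>2"
  have c4: "?cc < (c 4)\<^sup>2" and d4: "?dd \<le> (d 4)\<^sup>2" and
    cd: "c 4 * d 4 = c 1 * d 1 + c 2 * d 2 + c 3 * d 3"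
    using p px x unfolding c d e(2) power2_eq_square by linarith+
  have "(c 4)\<^sup>2 * (d 4)\<^sup>2 = (c 1 * d 1 + c 2 * d 2 + c 3 * d 3)\<^sup>2"
    by (simp flip: cd add: power_mult_distrib)
  \<comment> \<open>Lagrange's identity: the subtracted terms are the squared components of a cross
    product.\<close>
  also have "\<dots> = ?cc * ?dd -
      ((c 1 * d 2 - c 2 * d 1)\<^sup>2 + (c 2 * d 3 - c 3 * d 2)\<^sup>2 + (c 3 * d 1 - c 1 * d 3)\<^sup>2)"
    by (simp add: power2_eq_square algebra_simps)
  also have "\<dots> \<le> ?cc * ?dd"
    by (simp only: diff_le_eq le_add_same_cancel1) simp
  also have "\<dots> \<le> ?cc * (d 4)\<^sup>2"
    using d4 by (intro mult_left_mono) auto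
  finally have "((c 4)\<^sup>2 - ?cc) * (d 4)\<^sup>2 \<le> 0"
    by (simp add: algebra_simps)
  \<comment> \<open>The first factor is positive because \<open>p\<close> is a positive
    vector.\<close>
  then have "d 4 = 0"
    using c4 by (auto simp: mult_le_0_iff)
  then have "(d 1)\<^sup>2 = 0 \<and> (d 2)\<^sup>2 = 0 \<and> (d 3)\<^sup>2 = 0"
    using d4 by (smt (verit) zero_le_power2 zero_power2)
  then show ?thesis using \<open>d 4 = 0\<close> by (simp add: d sum_4)
qed

section \<open>Isometries and Witt extension\<close>

lemma form_isometry_id: "form_isometry B (\<lambda>x. x)"
  by (simp add: form_isometry_def linear_ident bij_id [unfolded id_def])

lemma form_isometry_comp:
  "form_isometry B f \<Longrightarrow> form_isometry B g \<Longrightarrow> form_isometry B (g \<circ> f)"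
  by (auto simp: form_isometry_def linear_compose bij_comp)

lemma form_isometry_inv:
  assumes "form_isometry B f"
  shows "form_isometry B (inv f)"
proof -
  have f: "linear f" "bij f" "\<And>x y. B (f x) (f y) = B x y"
    using assms by (auto simp: form_isometry_def)
  have "B (inv f x) (inv f y) = B x y" for x y
    using f(3) [of "inv f x" "inv f y"] f(2) by (simp add: bij_is_surj surj_f_inv_f)
  moreover have "linear (inv f)"
  proof (rule linearI)
    note inj = injD [OF bij_is_inj [OF f(2)]] and sf = surj_f_inv_f [OF bij_is_surj [OF f(2)]]
    show "inv f (x + y) = inv f x + inv f y" for x y
      by (rule inj) (simp add: sf linear_add [OF f(1)])
    show "inv f (c *\<^sub>R x) = c *\<^sub>R inv f x" for c x
      by (rule inj) (simp add: sf linear_scale [OF f(1)])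
  qed
  ultimately show ?thesis
    using f(2) by (simp add: form_isometry_def bij_imp_bij_inv)
qed

text \<open>The reflection in the hyperplane orthogonal to \<open>x - y\<close>; it exists because
  that vector is not null. A vector with equal products with \<open>x\<close> and \<open>y\<close>
  lies in the hyperplane.\<close>

lemma form_isometry_reflection:
  assumes L: "lorentzian B" and xy: "B x x = B y y" and n: "B (x - y) (x - y) \<noteq> 0"
  obtains f where "form_isometry B f" "f x = y" "\<And>z. B z x = B z y \<Longrightarrow> f z = z"
proof -
  note bil = bilinear_form_simps [OF lorentzianD(1) [OF L]]
  define n where "n = x - y"
  define f where "f z = z - (2 * B z n / B n n) *\<^sub>R n" for z
  have nn: "B n n \<noteq> 0" using n by (simp add: n_def)
  \<comment> \<open>Thus the coefficient of \<open>n\<close> in \<open>f x\<close> is 1, and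
    \<open>f x = x - n = y\<close>.\<close>
  have B2: "2 * B x n = B n n"
    using xy by (simp add: n_def bil lorentzianD(2) [OF L, of y x])
  have "linear f"
    by (rule linearI) (simp_all add: f_def bil algebra_simps add_divide_distrib)
  moreover have "f (f z) = z" for z
    using nn by (simp add: f_def bil)
  then have "bij f" by (rule involuntory_imp_bij)
  moreover have "B (f z) (f w) = B z w" for z w
    using nn by (simp add: f_def bil lorentzianD(2) [OF L, of n w])
  ultimately have "form_isometry B f"
    by (simp add: form_isometry_def)
  moreover have "f x = y"
    using nn by (simp add: f_def B2) (simp add: n_def)
  moreover have "f z = z" if "B z x = B z y" for z
    using that by (simp add: f_def n_def bil)
  ultimately show ?thesis using that by blast
qed

text \<open>Witt's extension theorem, for families whose span contains a positive vector: such a span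
  is nondegenerate, so linear relations need not be matched separately.\<close>

lemma form_isometry_extend_positive:
  assumes L: "lorentzian B" and "finite I"
    and p: "B p p > 0" "B p p = B q q"
    and xy: "\<And>i j. i \<in> I \<Longrightarrow> j \<in> I \<Longrightarrow> B (x i) (x j) = B (y i) (y j)"
    and pq: "\<And>i. i \<in> I \<Longrightarrow> B p (x i) = B q (y i)"
  shows "\<exists>f. form_isometry B f \<and> f p = q \<and> (\<forall>i\<in>I. f (x i) = y i)"
  using \<open>finite I\<close> xy pq
proof (induction I)
  case empty
  note bil = bilinear_form_simps [OF lorentzianD(1) [OF L]]
  show ?case
  proof (cases "B (p - q) (p - q) = 0")
    case True
    \<comment> \<open>If \<open>p - q\<close> is null, then \<open>p + q\<close> is positive and
      orthogonal to it, which forces \<open>p = q\<close>.\<close>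
    then have "B p q = B p p"
      using p by (simp add: bil lorentzianD(2) [OF L, of q p])
    then have "B (p + q) (p + q) > 0" "B (p + q) (p - q) = 0"
      using p by (simp_all add: bil lorentzianD(2) [OF L, of q p])
    then have "p - q = 0"
      using lorentzian_orthogonal_eq_0 [OF L] True by force
    then show ?thesis using form_isometry_id by (intro exI [where x = "\<lambda>x. x"]) simp
  next
    case False
    then show ?thesis using form_isometry_reflection [OF L p(2)] by (metis empty_iff)
  qed
next
  case (insert k I)
  note bil = bilinear_form_simps [OF lorentzianD(1) [OF L]]
  obtain f where f: "form_isometry B f" "f p = q" "\<forall>i\<in>I. f (x i) = y i"
    using insert by auto
  have iso: "B (f z) (f w) = B z w" for z w
    using f(1) by (simp add: form_isometry_def)
  have q: "B q (f (x k)) = B q (y k)"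
    using insert.prems(2) [of k] iso [of p "x k"] f(2) by simp
  have I: "B (y i) (f (x k)) = B (y i) (y k)" if "i \<in> I" for i
    using insert.prems(1) [of i k] iso [of "x i" "x k"] f(3) that by simp
  have k: "B (f (x k)) (f (x k)) = B (y k) (y k)"
    using insert.prems(1) [of k k] iso by simp
  show ?case
  proof (cases "B (f (x k) - y k) (f (x k) - y k) = 0")
    case True
    \<comment> \<open>The difference is null and, by \<open>q\<close>, orthogonal to the positive
      vector \<open>q\<close>.\<close>
    have "f (x k) - y k = 0"
      by (rule lorentzian_orthogonal_eq_0 [OF L, of q]) (use p q True in \<open>simp_all add: bil\<close>)
    then show ?thesis using f by auto
  next
    case False
    \<comment> \<open>The correcting reflection keeps what is already matched: \<open>q\<close> and
      each earlier \<open>y i\<close> have equal products with \<open>f (x k)\<close> and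
      \<open>y k\<close>, so \<open>g\<close> fixes them.\<close>
    obtain g where g: "form_isometry B g" "g (f (x k)) = y k"
      "\<And>z. B z (f (x k)) = B z (y k) \<Longrightarrow> g z = z"
      using form_isometry_reflection [OF L k False] by metis
    then show ?thesis
      using f(2,3) I q
      by (intro exI [where x = "g \<circ> f"] conjI form_isometry_comp [OF f(1) g(1)]) (auto simp: g(2,3))
  qed
qed

section \<open>Tetrahedra and their doubly stochastic Gram matrices\<close>

text \<open>Diagonalizing \<open>gram_of S\<close> by the Klein four-group characters gives one
  positive eigenvalue and three that are at most 0, which fits the signature; vertices can then be
  written down.\<close>

lemma gram_of_realizable:
  fixes B :: "'v::real_vector \<Rightarrow> 'v \<Rightarrow> real"
  assumes L: "lorentzian B" and S: "S \<in> Delta"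
  obtains v :: "4 \<Rightarrow> 'v" where "\<And>i. v i \<noteq> 0" "\<And>i j. B (v i) (v j) = gram_of S $ i $ j"
proof -
  obtain e :: "4 \<Rightarrow> 'v" where e: "\<And>c d. B (\<Sum>i\<in>UNIV. c i *\<^sub>R e i) (\<Sum>i\<in>UNIV. d i *\<^sub>R e i) =
       c 4 * d 4 - c 1 * d 1 - c 2 * d 2 - c 3 * d 3"
    by (rule lorentzian_coordinates [OF L]) (rule that)
  \<comment> \<open>The columns of \<open>D\<close> are the characters, scaled so that their squared
    lengths are the absolute eigenvalues \<open>1 - 2 * S $ k\<close> and 1. Membership in
    \<open>Delta\<close> makes the radicands nonnegative.\<close>
  define m where "m k = sqrt (1 - 2 * S $ k) / 2" for k :: 3
  define D :: "real^4^4" where "D = vector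
    [vector [m 1, m 2, m 3, 1/2], vector [m 1, - m 2, - m 3, 1/2],
     vector [- m 1, m 2, - m 3, 1/2], vector [- m 1, - m 2, m 3, 1/2]]"
  define v where "v i = (\<Sum>k\<in>UNIV. (D $ i $ k) *\<^sub>R e k)" for i
  have m: "m k * m k = (1 - 2 * S $ k) / 4" for k
    using S by (simp add: m_def Delta_iff field_simps)
  have sum: "S $ 1 + S $ 2 + S $ 3 = 1"
    using S by (simp add: Delta_iff sum_3)
  have "\<forall>i j. B (v i) (v j) = gram_of S $ i $ j"
    using sum by (simp add: v_def e forall_4 D_def gram_of_nth m) (simp add: field_simps)
  moreover have "v i \<noteq> 0" for i
  proof
    assume "v i = 0"
    \<comment> \<open>Pairing with \<open>e 4\<close>, written as a coordinate sum so that
      \<open>e\<close> applies, reads off the last entry of row \<open>i\<close> of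
      \<open>D\<close>, which is 1/2.\<close>
    then have "B (v i) (\<Sum>k\<in>UNIV. (if k = 4 then 1 else 0) *\<^sub>R e k) = 0"
      by (simp add: bilinear_lzero [OF lorentzianD(1) [OF L]])
    moreover have "D $ i $ 4 = 1/2"
      using exhaust_4 [of i] by (auto simp: D_def)
    ultimately show False
      unfolding v_def e by simp
  qed
  ultimately show ?thesis using that by blast
qed

lemma ideal_gram_diagonal:
  assumes L: "lorentzian B" and "span {v} \<in> ideal_points B"
  shows "B v v = 0"
proof -
  obtain p where p: "span {v} = span {p}" "B p p = 0"
    using assms(2) by (auto simp: ideal_points_def)
  then have "v \<in> span {p}" by (metis singletonI span_base)
  then obtain c where "v = c *\<^sub>R p" by (auto simp: span_singleton)
  then show ?thesis using p by (simp add: bilinear_form_simps [OF lorentzianD(1) [OF L]])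
qed

text \<open>Converse to realizability: symmetry, zero diagonal and unit row sums give the shape of
  the matrix, and the signature gives the triangle inequalities.\<close>

lemma ds_gram_matrix_eq_gram_of:
  assumes L: "lorentzian B" and P: "P \<in> labelled_ideal_tetrahedra B" and G: "ds_gram_matrix B P G"
  obtains S v where "S \<in> Delta" "G = gram_of S" "\<And>i. P i = span {v i}"
    "\<And>i j. B (v i) (v j) = G $ i $ j"
proof -
  note bil = bilinear_form_simps [OF lorentzianD(1) [OF L]]
  obtain v where v: "\<And>i. P i = span {v i}" "G = (\<chi> i j. B (v i) (v j))"
    using G by (auto simp: ds_gram_matrix_def is_gram_matrix_def)
  have Gv: "B (v i) (v j) = G $ i $ j" for i j
    by (simp add: v(2))
  have diag: "G $ i $ i = 0" for i
    using ideal_gram_diagonal [OF L, of "v i"] P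
    by (simp add: Gv labelled_ideal_tetrahedra_def flip: v(1))
  have sym: "G $ i $ j = G $ j $ i" for i j
    by (simp add: lorentzianD(2) [OF L, of "v i"] flip: Gv)
  define S :: "real^3" where "S = vector [G $ 1 $ 2, G $ 1 $ 3, G $ 1 $ 4]"
  have row: "G $ i $ 1 + G $ i $ 2 + G $ i $ 3 + G $ i $ 4 = 1" for i
    using G by (simp add: ds_gram_matrix_def doubly_stochastic_def sum_4)
  \<comment> \<open>Opposite edges agree: adding two row equations and subtracting the other two
    leaves twice the difference of one opposite pair.\<close>
  have "G $ 3 $ 4 = G $ 1 $ 2" "G $ 2 $ 4 = G $ 1 $ 3" "G $ 2 $ 3 = G $ 1 $ 4"
    using row [of 1] row [of 2] row [of 3] row [of 4] diag sym [of 2 1] sym [of 3 1] sym [of 4 1]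
      sym [of 3 2] sym [of 4 2] sym [of 4 3]
    by simp_all
  then have GS: "G = gram_of S"
    using diag sym [of 2 1] sym [of 3 1] sym [of 4 1] sym [of 3 2] sym [of 4 2] sym [of 4 3]
    by (simp add: vec_eq_iff [of G] forall_4 vec_eq_iff [of "G $ _"] gram_of_nth S_def)
  have sum: "S $ 1 + S $ 2 + S $ 3 = 1"
    using row [of 1] diag by (simp add: S_def)
  txt \<open>The characters of the Klein four-group are eigenvectors of \<open>gram_of S\<close> with eigenvalues
    \<open>1\<close> and \<open>2 * S $ k - 1\<close>; by the signature, only the first of these can be positive.\<close>
  define p where "p = v 1 + v 2 + v 3 + v 4"
  have pp: "B p p > 0"
    using sum by (simp add: p_def bil Gv GS gram_of_nth)
  have neg: "B x x \<le> 0" if "B p x = 0" for x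
    using lorentzian_orthogonal_eq_0 [OF L pp that] by (cases "B x x \<le> 0") (auto simp: bil)
  have "B (v 1 + v 2 - v 3 - v 4) (v 1 + v 2 - v 3 - v 4) \<le> 0"
    "B (v 1 - v 2 + v 3 - v 4) (v 1 - v 2 + v 3 - v 4) \<le> 0"
    "B (v 1 - v 2 - v 3 + v 4) (v 1 - v 2 - v 3 + v 4) \<le> 0"
    by (rule neg; simp add: p_def bil Gv GS gram_of_nth)+
  then have "S \<in> Delta"
    using sum by (simp add: Delta_def bil Gv GS gram_of_nth)
  then show ?thesis using that GS v(1) Gv by blast
qed

section \<open>Congruence as an equivalence relation\<close>

lemma equiv_tetrahedron_congruence:
  "equiv (labelled_ideal_tetrahedra B) (tetrahedron_congruence B)"
proof (rule equivI)
  show "tetrahedron_congruence B \<subseteq> labelled_ideal_tetrahedra B \<times> labelled_ideal_tetrahedra B"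
    by (auto simp: tetrahedron_congruence_def)
  show "refl_on (labelled_ideal_tetrahedra B) (tetrahedron_congruence B)"
  proof (rule refl_onI)
    show "(P, P) \<in> tetrahedron_congruence B" if "P \<in> labelled_ideal_tetrahedra B" for P
    proof -
      have "\<exists>f \<sigma>. form_isometry B f \<and> \<sigma> permutes UNIV \<and> (\<forall>i. f ` P i = P (\<sigma> i))"
        by (rule exI [where x = "\<lambda>x. x"], rule exI [where x = id])
          (simp add: form_isometry_id permutes_id)
      then show ?thesis
        using that by (simp add: tetrahedron_congruence_def)
    qed
  qed
  show "sym (tetrahedron_congruence B)"
  proof (rule symI)
    fix P Q
    assume PQ: "(P, Q) \<in> tetrahedron_congruence B"
    then obtain f \<sigma> where f: "form_isometry B f" and \<sigma>: "\<sigma> permutes UNIV"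
      and fP: "\<And>i. f ` P i = Q (\<sigma> i)"
      by (auto simp: tetrahedron_congruence_def)
    have "bij f" using f by (simp add: form_isometry_def)
    then have "inv f ` Q j = P (inv \<sigma> j)" for j
      using fP [of "inv \<sigma> j"] permutes_inverses(1) [OF \<sigma>]
      by (metis bij_is_inj image_inv_f_f)
    then show "(Q, P) \<in> tetrahedron_congruence B"
      using PQ form_isometry_inv [OF f] permutes_inv [OF \<sigma>]
      unfolding tetrahedron_congruence_def by blast
  qed
  show "trans (tetrahedron_congruence B)"
  proof (rule transI)
    fix P Q R
    assume PQ: "(P, Q) \<in> tetrahedron_congruence B" and QR: "(Q, R) \<in> tetrahedron_congruence B"
    obtain f \<sigma> where f: "form_isometry B f" "\<sigma> permutes UNIV" "\<And>i. f ` P i = Q (\<sigma> i)"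
      using PQ by (auto simp: tetrahedron_congruence_def)
    obtain g \<tau> where g: "form_isometry B g" "\<tau> permutes UNIV" "\<And>i. g ` Q i = R (\<tau> i)"
      using QR by (auto simp: tetrahedron_congruence_def)
    have "(g \<circ> f) ` P i = R ((\<tau> \<circ> \<sigma>) i)" for i
      unfolding image_comp [symmetric] f(3) g(3) by simp
    then show "(P, R) \<in> tetrahedron_congruence B"
      using PQ QR form_isometry_comp [OF f(1) g(1)] permutes_compose [OF f(2) g(2)]
      unfolding tetrahedron_congruence_def by blast
  qed
qed

section \<open>Determinant and permanent as a complete invariant\<close>

lemma Delta_eq_up_to_perm:
  assumes S: "S \<in> Delta" and T: "T \<in> Delta"
    and det: "det (gram_of S) = det (gram_of T)"
    and per: "permanent (gram_of S) = permanent (gram_of T)"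
  shows "(S $ 1, S $ 2, S $ 3) \<in> {(T $ 1, T $ 2, T $ 3), (T $ 1, T $ 3, T $ 2), (T $ 2, T $ 1, T $ 3),
    (T $ 2, T $ 3, T $ 1), (T $ 3, T $ 1, T $ 2), (T $ 3, T $ 2, T $ 1)}"
proof (rule triple_eq_if_power_sums_eq)
  \<comment> \<open>The second elementary symmetric function is expressed through the squares, which
    the permanent controls, so that only the product of the coordinates remains to be
    compared.\<close>
  have expand: "det (gram_of R) = 2 * (R $ 1 * R $ 1 + R $ 2 * R $ 2 + R $ 3 * R $ 3) - 1
      + 8 * (R $ 1 * R $ 2 * R $ 3)" if "R \<in> Delta" for R
  proof -
    have 1: "R $ 3 = 1 - R $ 1 - R $ 2" using that by (simp add: Delta_def)
    show ?thesis unfolding det_gram_of by (simp add: sum_3 prod_UNIV_3 1) (simp add: algebra_simps)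
  qed
  show "S $ 1 + S $ 2 + S $ 3 = T $ 1 + T $ 2 + T $ 3"
    using S T by (simp add: Delta_def)
  \<comment> \<open>Both permanents are squares of nonnegative sums, so the sums agree.\<close>
  have "(\<Sum>i\<in>UNIV. (S $ i)\<^sup>2) = (\<Sum>i\<in>UNIV. (T $ i)\<^sup>2)"
    using per unfolding permanent_gram_of by (rule power2_eq_imp_eq) (simp_all add: sum_nonneg)
  then show sq: "(S $ 1)\<^sup>2 + (S $ 2)\<^sup>2 + (S $ 3)\<^sup>2 = (T $ 1)\<^sup>2 + (T $ 2)\<^sup>2 + (T $ 3)\<^sup>2"
    by (simp add: sum_3)
  show "S $ 1 * S $ 2 * S $ 3 = T $ 1 * T $ 2 * T $ 3"
    using det sq by (simp add: expand S T power2_eq_square)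
qed

text \<open>Equal invariants allow a relabelling of the vertices of \<open>P\<close> that makes the
  Gram matrices equal; Witt extension then supplies the isometry.\<close>

lemma tetrahedron_congruence_if_det_permanent_eq:
  assumes L: "lorentzian B"
    and P: "P \<in> labelled_ideal_tetrahedra B" and Q: "Q \<in> labelled_ideal_tetrahedra B"
    and G: "ds_gram_matrix B P G" and H: "ds_gram_matrix B Q H"
    and det: "det H = det G" and per: "permanent H = permanent G"
  shows "(P, Q) \<in> tetrahedron_congruence B"
proof -
  note bil = bilinear_form_simps [OF lorentzianD(1) [OF L]]
  obtain T v where T: "T \<in> Delta" "G = gram_of T" "\<And>i. P i = span {v i}"
    "\<And>i j. B (v i) (v j) = G $ i $ j"
    using ds_gram_matrix_eq_gram_of [OF L P G] by metis
  obtain S w where S: "S \<in> Delta" "H = gram_of S" "\<And>i. Q i = span {w i}"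
    "\<And>i j. B (w i) (w j) = H $ i $ j"
    using ds_gram_matrix_eq_gram_of [OF L Q H] by metis
  obtain \<pi> where \<pi>: "\<pi> permutes UNIV" "\<And>i j. H $ i $ j = G $ \<pi> i $ \<pi> j"
    using gram_of_relabel(2) [OF Delta_eq_up_to_perm [OF S(1) T(1)]] det per S(2) T(2) by metis
  \<comment> \<open>These sums are the positive vectors for Witt extension: their square is the sum
    of all Gram entries, namely 4.\<close>
  define p q where "p = (\<Sum>i\<in>UNIV. v (\<pi> i))" and "q = (\<Sum>i\<in>UNIV. w i)"
  have eq: "B (v (\<pi> i)) (v (\<pi> j)) = B (w i) (w j)" for i j
    by (simp add: T(4) S(4) \<pi>(2))
  have pq: "B p p = B q q" "B p (v (\<pi> i)) = B q (w i)" for i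
    by (simp_all add: p_def q_def sum_4 bil eq)
  have "B q q > 0"
    using S(1) by (simp add: q_def sum_4 bil S(4) S(2) gram_of_nth Delta_def)
  then obtain f where f: "form_isometry B f" "\<And>i. f (v (\<pi> i)) = w i"
    using form_isometry_extend_positive [OF L, of UNIV p q "\<lambda>i. v (\<pi> i)" w] pq eq by auto
  \<comment> \<open>The inverse appears because \<open>f\<close> sends the representative with index
    \<open>\<pi> i\<close> to the one with index \<open>i\<close>.\<close>
  have "f ` P i = Q (inv \<pi> i)" for i
  proof -
    have "f (v i) = w (inv \<pi> i)"
      using f(2) [of "inv \<pi> i"] by (simp add: permutes_inverses [OF \<pi>(1)])
    then show ?thesis
      using f(1) by (simp add: T(3) S(3) form_isometry_def flip: linear_span_image)
  qed
  then show ?thesis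
    using P Q f(1) permutes_inv [OF \<pi>(1)] by (auto simp: tetrahedron_congruence_def)
qed

lemma labelled_ideal_tetrahedron_exists:
  assumes L: "lorentzian B" and T: "T \<in> Delta"
  obtains P where "P \<in> labelled_ideal_tetrahedra B" "ds_gram_matrix B P (gram_of T)"
proof -
  obtain v where v: "\<And>i. v i \<noteq> 0" "\<And>i j. B (v i) (v j) = gram_of T $ i $ j"
    using gram_of_realizable [OF L T] by metis
  have "is_gram_matrix B (\<lambda>i. span {v i}) (gram_of T)"
    unfolding is_gram_matrix_def using v by (intro exI [where x = v]) (simp add: vec_eq_iff)
  \<comment> \<open>Nonnegativity of a coordinate comes from adding the two triangle inequalities
    that bound the other coordinates.\<close>
  moreover have "doubly_stochastic (gram_of T)"
    using T by (auto simp: doubly_stochastic_def forall_4 sum_4 gram_of_nth Delta_def)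
  ultimately have G: "ds_gram_matrix B (\<lambda>i. span {v i}) (gram_of T)"
    by (simp add: ds_gram_matrix_def)
  have "gram_of T $ i $ i = 0" for i
    using exhaust_4 [of i] by (auto simp: gram_of_nth)
  then have "span {v i} \<in> ideal_points B" for i
    unfolding ideal_points_def using v by auto
  then have "(\<lambda>i. span {v i}) \<in> labelled_ideal_tetrahedra B"
    unfolding labelled_ideal_tetrahedra_def using G by blast
  then show ?thesis
    using G by (rule that)
qed

text \<open>All three quantities are built from sums and products over all coordinates, so
  reindexing suffices. The arbitrary \<open>g\<close> covers the coordinates, their squares and the
  factors of the determinant.\<close>

lemma Delta_permute:
  assumes T: "T \<in> Delta" and \<sigma>: "\<sigma> permutes UNIV"
  shows "(\<chi> i. T $ \<sigma> i) \<in> Delta"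
    and "det (gram_of (\<chi> i. T $ \<sigma> i)) = det (gram_of T)"
    and "permanent (gram_of (\<chi> i. T $ \<sigma> i)) = permanent (gram_of T)"
proof -
  have sum: "(\<Sum>i\<in>UNIV. g (T $ \<sigma> i)) = (\<Sum>i\<in>UNIV. g (T $ i))" for g :: "real \<Rightarrow> real"
    using sum.permute [OF \<sigma>, of "\<lambda>i. g (T $ i)"] by (simp add: o_def)
  have prod: "(\<Prod>i\<in>UNIV. g (T $ \<sigma> i)) = (\<Prod>i\<in>UNIV. g (T $ i))" for g :: "real \<Rightarrow> real"
    using prod.permute [OF \<sigma>, of "\<lambda>i. g (T $ i)"] by (simp add: o_def)
  show "(\<chi> i. T $ \<sigma> i) \<in> Delta"
    using T sum [of "\<lambda>x. x"] by (simp add: Delta_iff)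
  show "det (gram_of (\<chi> i. T $ \<sigma> i)) = det (gram_of T)"
    using sum [of "\<lambda>x. x"] prod [of "\<lambda>x. (\<Sum>i\<in>UNIV. T $ i) - 2 * x"] by (simp add: det_gram_of)
  show "permanent (gram_of (\<chi> i. T $ \<sigma> i)) = permanent (gram_of T)"
    using sum [of "\<lambda>x. x\<^sup>2"] by (simp add: permanent_gram_of)
qed

theorem theorem4p1:
  fixes B :: "'v::real_vector \<Rightarrow> 'v \<Rightarrow> real"
    and T :: "real^3"
    and \<alpha> \<beta> :: real
  assumes "lorentzian B"
    and "T \<in> Delta"
    and "\<alpha> = det (gram_of T)"
    and "\<beta> = permanent (gram_of T)"
  shows "{T' \<in> Delta. det (gram_of T') = \<alpha> \<and> permanent (gram_of T') = \<beta>}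
           = {(\<chi> i. T $ \<sigma> i) | \<sigma>. \<sigma> permutes UNIV}
       \<and> (\<exists>!C. C \<in> labelled_ideal_tetrahedra B // tetrahedron_congruence B \<and>
            (\<exists>P\<in>C. \<exists>G. ds_gram_matrix B P G \<and> det G = \<alpha> \<and> permanent G = \<beta>))"
proof (rule conjI)
  show "{T' \<in> Delta. det (gram_of T') = \<alpha> \<and> permanent (gram_of T') = \<beta>}
      = {(\<chi> i. T $ \<sigma> i) | \<sigma>. \<sigma> permutes UNIV}" (is "?L = ?R")
  proof
    show "?L \<subseteq> ?R"
      using gram_of_relabel(1) [OF Delta_eq_up_to_perm [OF _ assms(2)]] assms(3,4) by blast
    show "?R \<subseteq> ?L"
      using Delta_permute [OF assms(2)] assms(3,4) by blast
  qed
next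
  note eqv = equiv_tetrahedron_congruence [of B]
  \<comment> \<open>A realization of \<open>T\<close> itself represents the class whose existence is
    claimed.\<close>
  obtain P where P: "P \<in> labelled_ideal_tetrahedra B" "ds_gram_matrix B P (gram_of T)"
    using labelled_ideal_tetrahedron_exists [OF assms(1,2)] by metis
  show "\<exists>!C. C \<in> labelled_ideal_tetrahedra B // tetrahedron_congruence B \<and>
      (\<exists>P\<in>C. \<exists>G. ds_gram_matrix B P G \<and> det G = \<alpha> \<and> permanent G = \<beta>)"
  proof (rule ex_ex1I)
    show "\<exists>C. C \<in> labelled_ideal_tetrahedra B // tetrahedron_congruence B \<and>
        (\<exists>P\<in>C. \<exists>G. ds_gram_matrix B P G \<and> det G = \<alpha> \<and> permanent G = \<beta>)"
      using quotientI [OF P(1)] equiv_class_self [OF eqv P(1)] P(2) assms(3,4) by blast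
  next
    fix C D
    assume C: "C \<in> labelled_ideal_tetrahedra B // tetrahedron_congruence B \<and>
        (\<exists>P\<in>C. \<exists>G. ds_gram_matrix B P G \<and> det G = \<alpha> \<and> permanent G = \<beta>)"
      and D: "D \<in> labelled_ideal_tetrahedra B // tetrahedron_congruence B \<and>
        (\<exists>P\<in>D. \<exists>G. ds_gram_matrix B P G \<and> det G = \<alpha> \<and> permanent G = \<beta>)"
    obtain P G where PG: "P \<in> C" "ds_gram_matrix B P G" "det G = \<alpha>" "permanent G = \<beta>"
      using C by blast
    obtain Q H where QH: "Q \<in> D" "ds_gram_matrix B Q H" "det H = \<alpha>" "permanent H = \<beta>"
      using D by blast
    \<comment> \<open>It is enough to compare one witness from each class, since congruent members
      make the classes equal.\<close>
    have "P \<in> labelled_ideal_tetrahedra B" "Q \<in> labelled_ideal_tetrahedra B"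
      using C D PG(1) QH(1) in_quotient_imp_subset [OF eqv] by blast+
    then have "(P, Q) \<in> tetrahedron_congruence B"
      by (rule tetrahedron_congruence_if_det_permanent_eq [OF assms(1) _ _ PG(2) QH(2)])
        (simp_all add: PG QH)
    then show "C = D"
      using quotient_eqI [OF eqv] C D PG(1) QH(1) by blast
  qed
qed

end
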